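(* Let $(G,\mathcal{F})$ be a Gaussian sheaf with stalk dimension $d$ and restriction maps in $O(d)$ over a finite connected undirected graph $G=(V,E)$, and suppose the transport is path-independent. Then $H^0(G,\mathcal{F})$ and $\mathcal{G}(\mathbb{R}^d)$ are in bijection.
   Context: $\mathcal{G}(\mathbb{R}^d)$ is the set of (possibly degenerate) Gaussian distributions $\mathcal{N}(\mu,\Sigma)$ on $\mathbb{R}^d$, identified with pairs $(\mu,\Sigma)$, $\mu\in\mathbb{R}^d$, $\Sigma$ symmetric positive semidefinite. For $A\in\mathbb{R}^{d\times d}$ put $\Phi_A(\mu,\Sigma)=(A\mu,A\Sigma A^\top)$. A Gaussian sheaf $(G,\mathcal{F})$ with stalk dimension $d$ assigns the stalk $\mathcal{G}(\mathbb{R}^d)$ to each vertex and each edge, and to each incident vertex–edge pair $v\unlhd e$ a matrix $\mathcal{F}_{v\unlhd e}\in\mathbb{R}^{d\times d}$, acting as the restriction map $\Phi_{\mathcal{F}_{v\unlhd e}}$ from the stalk at $v$ to the stalk at $e$. "Restriction maps in $O(d)$" means all $\mathcal{F}_{v\unlhd e}$ are orthogonal matrices. $H^0(G,\mathcal{F})$ is the set of global sections: families $\nu=(\nu_v)_{v\in V}$ with $\nu_v\in\mathcal{G}(\mathbb{R}^d)$ and $\Phi_{\mathcal{F}_{v\unlhd e}}(\nu_v)=\Phi_{\mathcal{F}_{u\unlhd e}}(\nu_u)$ for every edge $e$ with endpoints $v,u$. A path $\gamma=(w_0,w_1,\dots,w_m)$ is a sequence of vertices with consecutive vertices joined by edges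 $e_i=(w_i,w_{i+1})$. The transport along $\gamma$ is $\mathbf{P}^\gamma_{w_0\to w_m}=\Phi_{\mathcal{F}_{w_m\unlhd e_{m-1}}^\top}\circ\Phi_{\mathcal{F}_{w_{m-1}\unlhd e_{m-1}}}\circ\cdots\circ\Phi_{\mathcal{F}_{w_1\unlhd e_0}^\top}\circ\Phi_{\mathcal{F}_{w_0\unlhd e_0}}$. The transport is path-independent if $\mathbf{P}^{\gamma}_{v\to u}=\mathbf{P}^{\gamma'}_{v\to u}$ for all $v,u\in V$ and all paths $\gamma,\gamma'$ from $v$ to $u$. *)

theory Defs
  imports "HOL-Analysis.Analysis" "Graph_Theory.Digraph_Component_Vwalk"
begin

section \<open>Gaussian distributions and push-forward along a matrix\<close>

definition pos_semidef :: "real^'n^'n \<Rightarrow> bool" where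
  "pos_semidef S \<longleftrightarrow> transpose S = S \<and> (\<forall>x. 0 \<le> x \<bullet> (S *v x))"

text \<open>A possibly degenerate Gaussian on \<open>\<real>\<^sup>d\<close>, \<open>d = CARD('n)\<close>, is identified with its pair
  (mean, covariance).\<close>

definition gaussians :: "((real^'n) \<times> (real^'n^'n)) set" where
  "gaussians = {(m, S). pos_semidef S}"

definition Phi :: "real^'n^'n \<Rightarrow> (real^'n) \<times> (real^'n^'n) \<Rightarrow> (real^'n) \<times> (real^'n^'n)" where
  "Phi A = (\<lambda>(m, S). (A *v m, A ** S ** transpose A))"

lemma Phi_in_gaussians:
  assumes "x \<in> gaussians"
  shows "Phi A x \<in> gaussians"
proof -
  obtain m S where x: "x = (m, S)" by (cases x)
  with assms have sym: "transpose S = S" and psd: "\<And>y. 0 \<le> y \<bullet> (S *v y)"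
    by (auto simp: gaussians_def pos_semidef_def)
  have "transpose (A ** S ** transpose A) = A ** S ** transpose A"
    by (simp add: matrix_transpose_mul sym matrix_mul_assoc)
  moreover have "0 \<le> y \<bullet> ((A ** S ** transpose A) *v y)" for y
  proof -
    have "y \<bullet> ((A ** S ** transpose A) *v y) =
        (transpose A *v y) \<bullet> (S *v (transpose A *v y))"
      by (simp add: dot_lmul_matrix flip: matrix_vector_mul_assoc)
    then show ?thesis using psd by simp
  qed
  ultimately show ?thesis
    by (simp add: x gaussians_def pos_semidef_def Phi_def)
qed

section \<open>Gaussian sheaves\<close>

text \<open>An undirected graph is a symmetric digraph. The two arcs \<open>(u, v)\<close> and \<open>(v, u)\<close> are one
  and the same undirected edge \<open>{u, v}\<close>, so that the stalk over the edge and the restriction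
  maps into it do not depend on a direction.\<close>

definition uedges :: "'v pair_pre_digraph \<Rightarrow> 'v set set" where
  "uedges G = {{u, v} | u v. (u, v) \<in> parcs G}"

text \<open>All stalks being \<open>gaussians\<close>, a Gaussian sheaf on \<open>G\<close> is given by its matrices: \<open>F v e\<close>
  for \<open>v \<in> e \<in> uedges G\<close>. Values of \<open>F\<close> at non-incident pairs are irrelevant.\<close>

type_synonym ('v, 'n) gaussian_sheaf = "'v \<Rightarrow> 'v set \<Rightarrow> real^'n^'n"

definition orthogonal_sheaf :: "'v pair_pre_digraph \<Rightarrow> ('v, 'n::finite) gaussian_sheaf \<Rightarrow> bool" where
  "orthogonal_sheaf G F \<longleftrightarrow> (\<forall>e \<in> uedges G. \<forall>v \<in> e. orthogonal_matrix (F v e))"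

text \<open>Families indexed by the vertices are extensional functions (\<open>undefined\<close> outside
  \<open>pverts G\<close>), so that distinct functions are distinct families.\<close>

definition global_sections ::
  "'v pair_pre_digraph \<Rightarrow> ('v, 'n::finite) gaussian_sheaf \<Rightarrow> ('v \<Rightarrow> (real^'n) \<times> (real^'n^'n)) set" where
  "global_sections G F = {\<nu> \<in> pverts G \<rightarrow>\<^sub>E gaussians.
     \<forall>e \<in> uedges G. \<forall>v \<in> e. \<forall>u \<in> e. Phi (F v e) (\<nu> v) = Phi (F u e) (\<nu> u)}"

text \<open>Transport along a vertex walk \<open>(w\<^sub>0, \<dots>, w\<^sub>m)\<close>, given as the list of its vertices.
  The one-vertex walk (\<open>m = 0\<close>) gives the empty composition; the value at \<open>[]\<close> is irrelevant.\<close>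

fun transport ::
  "('v, 'n::finite) gaussian_sheaf \<Rightarrow> 'v vwalk \<Rightarrow> (real^'n) \<times> (real^'n^'n) \<Rightarrow> (real^'n) \<times> (real^'n^'n)" where
  "transport F [] = id"
| "transport F [v] = id"
| "transport F (v # w # p) =
     transport F (w # p) \<circ> Phi (transpose (F w {v, w})) \<circ> Phi (F v {v, w})"

text \<open>A \<open>vwalk\<close> may repeat vertices, as may the paths in the definition of transport; equality of transports is
  equality as maps on the stalk \<open>gaussians\<close>.\<close>

definition path_independent :: "'v pair_pre_digraph \<Rightarrow> ('v, 'n::finite) gaussian_sheaf \<Rightarrow> bool" where
  "path_independent G F \<longleftrightarrow>
     (\<forall>v \<in> pverts G. \<forall>u \<in> pverts G. \<forall>p q.
        vwalk p (with_proj G) \<and> hd p = v \<and> last p = u \<and>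
        vwalk q (with_proj G) \<and> hd q = v \<and> last q = u \<longrightarrow>
        (\<forall>x \<in> gaussians. transport F p x = transport F q x))"

end

theory Submission
  imports Defs
begin

text \<open>Evaluation at a root vertex \<open>r\<close> is the bijection. A global section is carried along any walk
  by the transport, so by connectedness its value at \<open>r\<close> determines it. Conversely, transporting a
  Gaussian from \<open>r\<close> to every vertex along a chosen walk gives a global section: the walk chosen for
  \<open>v\<close>, extended by an arc \<open>(v, u)\<close>, leads to \<open>u\<close>, so path independence yields compatibility along
  the edge.\<close>

lemma Phi_Phi: "Phi A (Phi B x) = Phi (A ** B) x"
  by (cases x) (simp add: Phi_def matrix_vector_mul_assoc matrix_transpose_mul matrix_mul_assoc)

lemma Phi_mat_1: "Phi (mat 1) x = x"
  by (cases x) (simp add: Phi_def transpose_mat)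

text \<open>\<open>Phi\<close> turns matrix products into compositions and \<open>mat 1\<close> into
  the identity, so an orthogonal restriction map is invertible and its transpose carries an edge
  stalk back to the vertex.\<close>

lemma Phi_transpose_Phi: "orthogonal_matrix A \<Longrightarrow> Phi (transpose A) (Phi A x) = x"
  by (simp add: Phi_Phi Phi_mat_1 orthogonal_matrix_def)

lemma Phi_Phi_transpose: "orthogonal_matrix A \<Longrightarrow> Phi A (Phi (transpose A) x) = x"
  by (simp add: Phi_Phi Phi_mat_1 orthogonal_matrix_def)

lemma transport_in_gaussians: "x \<in> gaussians \<Longrightarrow> transport F p x \<in> gaussians"
  by (induction p arbitrary: x rule: induct_list012) (simp_all add: Phi_in_gaussians)

text \<open>\<open>transport\<close> recurses at the start of a walk, whereas the construction of a
  section extends walks at their end.\<close>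

lemma transport_snoc:
  assumes "p \<noteq> []"
  shows "transport F (p @ [u]) x =
    Phi (transpose (F u {last p, u})) (Phi (F (last p) {last p, u}) (transport F p x))"
  using assms by (induction p arbitrary: x rule: induct_list012) simp_all

lemma uedgesI: "(u, v) \<in> parcs G \<Longrightarrow> {u, v} \<in> uedges G"
  by (auto simp: uedges_def)

text \<open>By compatibility, restricting \<open>\<nu> v\<close> to the edge gives the same Gaussian
  as restricting \<open>\<nu> w\<close>; the transposed map at \<open>w\<close> then recovers
  \<open>\<nu> w\<close>. Induction along the walk does the rest.\<close>

lemma transport_global_section:
  assumes "vwalk p (with_proj G)" and "orthogonal_sheaf G F" and "\<nu> \<in> global_sections G F"
  shows "transport F p (\<nu> (hd p)) = \<nu> (last p)"
  using assms
proof (induction p rule: induct_list012)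
  case (3 v w p)
  let ?e = "{v, w}"
  have walk: "vwalk (w # p) (with_proj G)" and "(v, w) \<in> parcs G"
    using "3.prems"(1) by (auto simp: vwalk_def)
  then have e: "?e \<in> uedges G" by (simp add: uedgesI)
  have "orthogonal_matrix (F w ?e)"
    using "3.prems"(2) e by (auto simp: orthogonal_sheaf_def)
  moreover have "Phi (F v ?e) (\<nu> v) = Phi (F w ?e) (\<nu> w)"
    using "3.prems"(3) e by (auto simp: global_sections_def)
  ultimately have "Phi (transpose (F w ?e)) (Phi (F v ?e) (\<nu> v)) = \<nu> w"
    by (simp add: Phi_transpose_Phi)
  with "3.IH"(2)[OF walk "3.prems"(2,3)] show ?case by simp
qed (auto simp: vwalk_def)

lemma inj_on_eval_global_sections:
  assumes "\<And>v. v \<in> pverts G \<Longrightarrow> \<exists>p. vwalk p (with_proj G) \<and> hd p = r \<and> last p = v"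
    and "orthogonal_sheaf G F"
  shows "inj_on (\<lambda>\<nu>. \<nu> r) (global_sections G F)"
proof (rule inj_onI)
  fix \<nu> \<nu>'
  assume \<nu>: "\<nu> \<in> global_sections G F" and \<nu>': "\<nu>' \<in> global_sections G F" and eq: "\<nu> r = \<nu>' r"
  have "\<nu> v = \<nu>' v" if v: "v \<in> pverts G" for v
  proof -
    obtain p where "vwalk p (with_proj G)" "hd p = r" "last p = v"
      using assms(1)[OF v] by blast
    with eq assms(2) show ?thesis
      using transport_global_section[of p G F \<nu>] transport_global_section[of p G F \<nu>'] \<nu> \<nu>' by simp
  qed
  \<comment> \<open>Sections are extensional, so agreement on \<open>pverts G\<close> gives equality
    of functions.\<close>
  moreover have "\<nu> \<in> pverts G \<rightarrow>\<^sub>E gaussians" "\<nu>' \<in> pverts G \<rightarrow>\<^sub>E gaussians"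
    using \<nu> \<nu>' by (auto simp: global_sections_def)
  ultimately show "\<nu> = \<nu>'" by (rule PiE_ext[rotated 2])
qed

lemma ex_global_section_through:
  assumes wf: "pair_sym_digraph G" and r: "r \<in> pverts G"
    and walks: "\<And>v. v \<in> pverts G \<Longrightarrow> \<exists>p. vwalk p (with_proj G) \<and> hd p = r \<and> last p = v"
    and orth: "orthogonal_sheaf G F" and indep: "path_independent G F"
    and x: "x \<in> gaussians"
  shows "\<exists>\<nu> \<in> global_sections G F. \<nu> r = x"
proof -
  interpret pair_sym_digraph G by (fact wf)
  obtain p where p: "\<And>v. v \<in> pverts G \<Longrightarrow> vwalk (p v) (with_proj G)"
    "\<And>v. v \<in> pverts G \<Longrightarrow> hd (p v) = r" "\<And>v. v \<in> pverts G \<Longrightarrow> last (p v) = v"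
    using walks by metis
  define \<nu> where "\<nu> = (\<lambda>v \<in> pverts G. transport F (p v) x)"
  \<comment> \<open>Path independence enters here: \<open>\<nu>\<close> may be computed along any
    walk from \<open>r\<close>, not only along the chosen \<open>p v\<close>.\<close>
  have \<nu>_last: "transport F q x = \<nu> (last q)" if q: "vwalk q (with_proj G)" "hd q = r" for q
  proof -
    have v: "last q \<in> pverts G" using q(1) by (auto simp: vwalk_def)
    have "transport F q x = transport F (p (last q)) x"
      using indep[unfolded path_independent_def, rule_format, OF r v] q p[OF v] x by blast
    with v show ?thesis by (simp add: \<nu>_def)
  qed
  have arc: "Phi (F u {v, u}) (\<nu> u) = Phi (F v {v, u}) (\<nu> v)" if vu: "(v, u) \<in> parcs G" for v u
  proof -
    have v: "v \<in> pverts G" and u: "u \<in> pverts G"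
      using vu by (auto dest: in_arcsD1 in_arcsD2)
    have ne: "p v \<noteq> []" using p(1)[OF v] by (auto simp: vwalk_def)
    \<comment> \<open>This walk to \<open>u\<close> need not be the chosen \<open>p u\<close>, but
      \<open>\<nu>_last\<close> applies to it all the same.\<close>
    have "vwalk (p v @ [u]) (with_proj G)"
      using p(1,3)[OF v] u vu ne by (auto simp: vwalk_def set_vwalk_arcs_snoc)
    then have "\<nu> u = transport F (p v @ [u]) x"
      using \<nu>_last p(2)[OF v] ne by simp
    also have "\<dots> = Phi (transpose (F u {v, u})) (Phi (F v {v, u}) (\<nu> v))"
      using p(3)[OF v] v ne by (simp add: transport_snoc \<nu>_def)
    finally have "\<nu> u = Phi (transpose (F u {v, u})) (Phi (F v {v, u}) (\<nu> v))" .
    moreover have "orthogonal_matrix (F u {v, u})"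
      using orth uedgesI[OF vu] by (auto simp: orthogonal_sheaf_def)
    \<comment> \<open>Applying \<open>Phi (F u {v, u})\<close> to both sides cancels the
      transpose.\<close>
    ultimately show ?thesis by (simp add: Phi_Phi_transpose)
  qed
  have "\<nu> \<in> global_sections G F"
    unfolding global_sections_def
  proof (intro CollectI conjI ballI)
    show "\<nu> \<in> pverts G \<rightarrow>\<^sub>E gaussians"
      using x by (auto simp: \<nu>_def transport_in_gaussians)
    \<comment> \<open>The edge comes from some arc; its endpoints in either order give
      \<open>arc\<close> or its mirror image, and equal endpoints are trivial.\<close>
    fix e v u assume "e \<in> uedges G" "v \<in> e" "u \<in> e"
    then show "Phi (F v e) (\<nu> v) = Phi (F u e) (\<nu> u)"
      using arc by (force simp: uedges_def)
  qed
  \<comment> \<open>The chosen \<open>p r\<close> may be a nontrivial closed walk; it is compared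
    with the walk \<open>[r]\<close>, whose transport is the identity.\<close>
  moreover have "\<nu> r = x"
    using \<nu>_last[of "[r]"] r by simp
  ultimately show ?thesis by blast
qed

theorem proposition4p4:
  fixes G :: "'v pair_pre_digraph"
    and F :: "('v, 'n::finite) gaussian_sheaf"
  assumes "pair_pseudo_graph G"
    and "Digraph_Component.connected (with_proj G)"
    and "orthogonal_sheaf G F"
    and "path_independent G F"
  shows "\<exists>f. bij_betw f (global_sections G F)
                (gaussians :: ((real^'n) \<times> (real^'n^'n)) set)"
proof -
  interpret pair_pseudo_graph G by (fact assms(1))
  have sc: "strongly_connected (with_proj G)"
    using symmetric_connected_imp_strongly_connected[OF sym_arcs assms(2)] .
  \<comment> \<open>Strong connectedness includes that the vertex set is nonempty, which supplies a
    root.\<close>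
  then obtain r where r: "r \<in> pverts G" by (auto simp: strongly_connected_def)
  have walks: "\<exists>p. vwalk p (with_proj G) \<and> hd p = r \<and> last p = v" if "v \<in> pverts G" for v
    using sc r that reachable_vwalk_conv by (auto simp: strongly_connected_def)
  have "(\<lambda>\<nu>. \<nu> r) ` global_sections G F = gaussians"
  proof
    show "(\<lambda>\<nu>. \<nu> r) ` global_sections G F \<subseteq> gaussians"
      using r by (auto simp: global_sections_def)
    show "gaussians \<subseteq> (\<lambda>\<nu>. \<nu> r) ` global_sections G F"
      using ex_global_section_through[OF pair_sym_digraph_axioms r walks assms(3,4)] by blast
  qed
  with inj_on_eval_global_sections[OF walks assms(3)] show ?thesis
    unfolding bij_betw_def by blast
qed

end
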